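(* There is a universal constant $C>0$ such that the following holds. Let $\alpha>0$, $\rho = 1+\alpha$, and let $f$ be an analytic function on $[-1,1]$ that is analytically continuable to the interior of the Bernstein ellipse $E_\rho$, where it is bounded in absolute value by $M$. Let $\delta \in (0, \frac1C\min(1,\alpha^2))$, $\varepsilon \in (0,1)$, and $b>1$. Then there is a polynomial $q$ of degree $O\left(\frac{b}{\delta}\log\frac{b}{\delta\varepsilon}\right)$ such that \[ \|f-q\|_{[-1,1]} \le M\varepsilon,\qquad \|q\|_{[-(1+\delta),\,1+\delta]} \le M,\qquad \|q\|_{[-b,-(1+\delta)]\cup[1+\delta,b]} \le M\varepsilon . \]
   Context: For $\rho>1$, the Bernstein ellipse is the curve $E_\rho = \{\frac12(z+z^{-1}) : z\in\mathbb{C},\ |z|=\rho\}$; its interior is the bounded region it encloses (which contains $[-1,1]$). For a function $g$ and a set $I\subset\mathbb{R}$, $\|g\|_I = \sup_{x\in I}|g(x)|$. The $O(\cdot)$ hides a universal constant, independent of $f, M, \alpha,\delta,\varepsilon,b$. *)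

theory Defs
  imports "HOL-Complex_Analysis.Complex_Analysis" "HOL-Computational_Algebra.Polynomial"
begin

definition bernstein_ellipse :: "real \<Rightarrow> complex set" where
  "bernstein_ellipse \<rho> = {(z + inverse z) / 2 | z. norm z = \<rho>}"

text \<open>
  The region enclosed by the ellipse is written \<open>inside (bernstein_ellipse \<rho>)\<close>, where
  \<open>inside S\<close> is the union of the bounded connected components of the complement of \<open>S\<close>.
\<close>

text \<open>
  The supremum is taken in the extended nonnegative reals, so that it is infinite for a
  function unbounded on \<open>I\<close> and \<open>0\<close> for empty \<open>I\<close>; a supremum in the reals would be
  unspecified in both cases.
\<close>

definition sup_norm_on :: "real set \<Rightarrow> (real \<Rightarrow> complex) \<Rightarrow> ennreal" where
  "sup_norm_on I g = (SUP x\<in>I. ennreal (norm (g x)))"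

end

theory Submission imports Defs begin

text \<open>
  Let \<open>\<bar>t\<bar> \<le> 1 + \<delta>/2\<close>. The disc of radius \<open>\<delta>\<close> about \<open>t\<close> lies in the ellipse, so by Cauchy's
  estimates the Taylor polynomial \<open>P\<^sub>t\<close> of \<open>F\<close> of order \<open>m\<close> at \<open>t\<close> is accurate to \<open>2M / 2^m\<close> within
  \<open>\<delta>/2\<close> of \<open>t\<close>. Let \<open>J\<close> be the \<open>2m\<close>-th power of a Dirichlet kernel of degree of order \<open>b/\<delta>\<close>, normalised to
  have integral 1: it is a nonnegative polynomial, and at distance \<open>y \<ge> \<delta>/2\<close> it is so small that
  it outweighs the growth \<open>(y/\<delta>)^m\<close> of \<open>P\<^sub>t\<close>. Hence the polynomial
  \<open>q(x) = \<integral> P\<^sub>t(x) J(t - x) dt\<close>, taken over these \<open>t\<close>, is up to tiny errors \<open>F(x) R(x)\<close> with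
  \<open>R(x) = \<integral> J(t - x) dt \<in> [0,1]\<close> near the interval and \<open>0\<close> outside, and \<open>R(x)\<close> is close to 1 on
  \<open>[-1,1]\<close>. Taking \<open>m\<close> of order \<open>ln (b / (\<delta>\<epsilon>))\<close> and dividing \<open>q\<close> by \<open>1 + E\<close>, where \<open>M * E\<close> bounds
  the errors, gives the exact bound \<open>M\<close>.
\<close>

section \<open>The Bernstein ellipse in terms of its foci\<close>

text \<open>Both focal distances are perfect squares divided by \<open>2 * z\<close>, so the
  parallelogram law for \<open>z\<close> and \<open>1\<close> evaluates their sum.\<close>

lemma focal_sum_joukowski:
  fixes z :: complex
  assumes "z \<noteq> 0"
  shows "norm ((z + inverse z) / 2 - 1) + norm ((z + inverse z) / 2 + 1) = norm z + 1 / norm z"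
proof -
  have "(z + inverse z) / 2 - 1 = (z - 1)\<^sup>2 / (2 * z)" "(z + inverse z) / 2 + 1 = (z + 1)\<^sup>2 / (2 * z)"
    using assms by (simp_all add: field_simps power2_eq_square)
  moreover have "(norm (z - 1))\<^sup>2 + (norm (z + 1))\<^sup>2 = 2 * (norm z)\<^sup>2 + 2"
    unfolding cmod_power2 by (simp add: power2_eq_square algebra_simps)
  ultimately have "norm ((z + inverse z) / 2 - 1) + norm ((z + inverse z) / 2 + 1) =
      (2 * (norm z)\<^sup>2 + 2) / (2 * norm z)"
    by (simp add: norm_divide norm_power norm_mult flip: add_divide_distrib)
  also have "\<dots> = norm z + 1 / norm z" using assms by (simp add: field_simps power2_eq_square)
  finally show ?thesis .
qed

text \<open>Turns the parametrised curve into a level set of a continuous function, whose strict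
  sublevel and superlevel sets are open and can be separated.\<close>

lemma bernstein_ellipse_eq_focal:
  assumes "\<rho> > 0"
  shows "bernstein_ellipse \<rho> = {w. norm (w - 1) + norm (w + 1) = \<rho> + 1 / \<rho>}"
proof (intro equalityI subsetI)
  fix w assume "w \<in> bernstein_ellipse \<rho>"
  then obtain z where "w = (z + inverse z) / 2" "norm z = \<rho>"
    unfolding bernstein_ellipse_def by auto
  with focal_sum_joukowski [of z] assms show "w \<in> {w. norm (w - 1) + norm (w + 1) = \<rho> + 1 / \<rho>}"
    by fastforce
next
  fix w :: complex assume sum: "w \<in> {w. norm (w - 1) + norm (w + 1) = \<rho> + 1 / \<rho>}"
  \<comment> \<open>A root of \<open>z^2 - 2 * w * z + 1 = 0\<close>; the other root is
    \<open>inverse z\<close> and gives the same \<open>w\<close>. The focal sum only tells that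
    \<open>norm z\<close> is \<open>\<rho>\<close> or \<open>1 / \<rho>\<close>, and in the second
    case the other root serves.\<close>
  define z where "z = w + csqrt (w\<^sup>2 - 1)"
  have z: "z\<^sup>2 + 1 = 2 * w * z"
  proof -
    have "(csqrt (w\<^sup>2 - 1))\<^sup>2 = w\<^sup>2 - 1" by (rule power2_csqrt)
    then show ?thesis unfolding z_def by algebra
  qed
  then have "z \<noteq> 0" by auto
  with z have w: "w = (z + inverse z) / 2"
    by (simp add: field_simps power2_eq_square)
  have "norm z > 0" using \<open>z \<noteq> 0\<close> by simp
  have "norm z + 1 / norm z = \<rho> + 1 / \<rho>"
    using sum focal_sum_joukowski [OF \<open>z \<noteq> 0\<close>] by (simp add: w)
  then have "(norm z - \<rho>) * (norm z * \<rho> - 1) = 0"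
    using \<open>norm z > 0\<close> \<open>\<rho> > 0\<close> by (simp add: field_simps)
  then consider "norm z = \<rho>" | "norm z * \<rho> = 1" by auto
  then show "w \<in> bernstein_ellipse \<rho>"
  proof cases
    case 1
    then show ?thesis unfolding bernstein_ellipse_def using w by blast
  next
    case 2
    then have "norm (inverse z) = \<rho>"
      using \<open>norm z > 0\<close> by (metis inverse_unique norm_inverse)
    moreover have "w = (inverse z + inverse (inverse z)) / 2" using w by simp
    ultimately show ?thesis unfolding bernstein_ellipse_def by blast
  qed
qed

text \<open>A connected set that misses the curve cannot meet both open sides \<open>?W\<close> and
  \<open>?V\<close>, so the component of \<open>z\<close> stays in \<open>?W\<close>, which is
  bounded.\<close>

lemma focal_region_subset_inside:
  assumes "\<rho> > 0"
  shows "{z. norm (z - 1) + norm (z + 1) < \<rho> + 1 / \<rho>} \<subseteq> inside (bernstein_ellipse \<rho>)"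
proof
  let ?W = "{z::complex. norm (z - 1) + norm (z + 1) < \<rho> + 1 / \<rho>}"
  let ?V = "{z::complex. norm (z - 1) + norm (z + 1) > \<rho> + 1 / \<rho>}"
  fix z assume z: "z \<in> ?W"
  then have notin: "z \<notin> bernstein_ellipse \<rho>"
    unfolding bernstein_ellipse_eq_focal [OF assms] by simp
  let ?C = "connected_component_set (- bernstein_ellipse \<rho>) z"
  have "?C \<subseteq> - bernstein_ellipse \<rho>" by (rule connected_component_subset)
  also have "\<dots> \<subseteq> ?W \<union> ?V"
    unfolding bernstein_ellipse_eq_focal [OF assms] by auto
  finally have C: "?C \<subseteq> ?W \<union> ?V" .
  have opn: "open ?W" "open ?V"
    by (intro open_Collect_less continuous_intros)+
  have "connected ?C" by simp
  then have "?W \<inter> ?C = {} \<or> ?V \<inter> ?C = {}"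
    using connectedD [OF _ opn _ C] by fastforce
  moreover have "z \<in> ?C" using notin by (simp add: connected_component_refl)
  ultimately have "?C \<subseteq> ?W" using z C by blast
  moreover have "bounded ?W"
  proof (rule boundedI)
    fix x assume "x \<in> ?W"
    moreover have "norm x \<le> norm (x - 1) + 1"
      using norm_triangle_ineq [of "x - 1" 1] by simp
    ultimately show "norm x \<le> \<rho> + 1 / \<rho> + 1"
      using norm_ge_zero [of "x + 1"] unfolding mem_Collect_eq by linarith
  qed
  ultimately have "bounded ?C" by (rule bounded_subset [rotated])
  then show "z \<in> inside (bernstein_ellipse \<rho>)" using notin by (simp add: inside_def)
qed

text \<open>The focal sum on the disc is at most \<open>2 + 4 * \<delta>\<close>, while the ellipse
  allows \<open>2 + \<alpha>^2 / (1 + \<alpha>)\<close>. That excess is at least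
  \<open>\<alpha>^2 / 2\<close> for \<open>\<alpha> \<le> 1\<close> and at least
  \<open>1 / 2\<close> otherwise, which explains \<open>min 1 (\<alpha>\<^sup>2)\<close> and the
  factor 8.\<close>

lemma cball_subset_focal_region:
  assumes "\<alpha> > 0" "\<delta> > 0" "\<delta> < min 1 (\<alpha>\<^sup>2) / 8" "\<bar>t\<bar> \<le> 1 + \<delta>"
  shows "cball (complex_of_real t) \<delta> \<subseteq> {z. norm (z - 1) + norm (z + 1) < 1 + \<alpha> + 1 / (1 + \<alpha>)}"
proof
  fix z assume "z \<in> cball (complex_of_real t) \<delta>"
  then have z: "norm (z - of_real t) \<le> \<delta>" by (simp add: dist_norm norm_minus_commute)
  have "norm (z - 1) \<le> norm (z - of_real t) + \<bar>t - 1\<bar>"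
    using norm_triangle_ineq [of "z - of_real t" "of_real (t - 1)"] by (simp del: of_real_diff add: of_real_diff [symmetric])
      (simp add: algebra_simps)
  moreover have "norm (z + 1) \<le> norm (z - of_real t) + \<bar>t + 1\<bar>"
    using norm_triangle_ineq [of "z - of_real t" "of_real (t + 1)"] by (simp del: of_real_add add: of_real_add [symmetric])
      (simp add: algebra_simps)
  moreover have "\<bar>t - 1\<bar> + \<bar>t + 1\<bar> \<le> 2 + 2 * \<delta>" using assms by linarith
  ultimately have "norm (z - 1) + norm (z + 1) \<le> 2 + 4 * \<delta>" using z by linarith
  also have "4 * \<delta> < \<alpha>\<^sup>2 / (1 + \<alpha>)"
  proof (cases "\<alpha> \<le> 1")
    case True
    then have "\<alpha>\<^sup>2 / 2 \<le> \<alpha>\<^sup>2 / (1 + \<alpha>)"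
      using assms by (intro divide_left_mono) auto
    then show ?thesis using assms(3) by linarith
  next
    case False
    have "(\<alpha> - 1) * (2 * \<alpha> + 1) \<ge> 0" using False by simp
    then have "1 / 2 \<le> \<alpha>\<^sup>2 / (1 + \<alpha>)"
      using False by (simp add: field_simps power2_eq_square)
    then show ?thesis using assms(3) by linarith
  qed
  also have "2 + \<alpha>\<^sup>2 / (1 + \<alpha>) = 1 + \<alpha> + 1 / (1 + \<alpha>)"
    using assms by (simp add: field_simps power2_eq_square)
  finally show "z \<in> {z. norm (z - 1) + norm (z + 1) < 1 + \<alpha> + 1 / (1 + \<alpha>)}" by simp
qed

section \<open>Concentrated polynomial kernels\<close>

text \<open>The Chebyshev recurrence in
  \<open>cos (2 * \<theta>) = 1 - 2 * (sin \<theta>)^2\<close>; each step raises the degree in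
  \<open>sin \<theta>\<close> by two.\<close>

lemma cos_even_multiple_poly:
  "\<exists>p :: real poly. degree p \<le> 2 * k \<and> (\<forall>\<theta>. poly p (sin \<theta>) = cos (real (2 * k) * \<theta>))"
proof (induction k rule: induct_nat_012)
  case 0
  show ?case by (intro exI [of _ 1]) simp
next
  case 1
  show ?case
    by (intro exI [of _ "[:1, 0, -2:]"]) (simp add: cos_double_sin power2_eq_square)
next
  case (ge2 k)
  then obtain p q :: "real poly"
    where p: "degree p \<le> 2 * k" "\<And>\<theta>. poly p (sin \<theta>) = cos (real (2 * k) * \<theta>)"
      and q: "degree q \<le> 2 * Suc k" "\<And>\<theta>. poly q (sin \<theta>) = cos (real (2 * Suc k) * \<theta>)"
    by auto
  let ?r = "[:2, 0, -4:] * q - p"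
  have "degree ([:2, 0, -4:] * q) \<le> 2 + 2 * Suc k"
    using degree_mult_le [of "[:2, 0, -4:]" q] q(1) by simp
  then have "degree ?r \<le> 2 * Suc (Suc k)"
    using p(1) by (intro degree_diff_le) auto
  moreover have "poly ?r (sin \<theta>) = cos (real (2 * Suc (Suc k)) * \<theta>)" for \<theta>
  proof -
    have "poly ?r (sin \<theta>) = 2 * cos (2 * \<theta>) * cos (real (2 * Suc k) * \<theta>) - cos (real (2 * k) * \<theta>)"
    proof -
      have "poly ?r (sin \<theta>) = (2 - 4 * (sin \<theta>)\<^sup>2) * poly q (sin \<theta>) - poly p (sin \<theta>)"
        by (simp add: power2_eq_square algebra_simps)
      also have "2 - 4 * (sin \<theta>)\<^sup>2 = 2 * cos (2 * \<theta>)" by (simp add: cos_double_sin)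
      finally show ?thesis unfolding p q .
    qed
    also have "2 * cos (2 * \<theta>) * cos (real (2 * Suc k) * \<theta>) =
        cos (real (2 * Suc k) * \<theta> + 2 * \<theta>) + cos (real (2 * Suc k) * \<theta> - 2 * \<theta>)"
      by (simp add: cos_add cos_diff)
    also have "real (2 * Suc k) * \<theta> + 2 * \<theta> = real (2 * Suc (Suc k)) * \<theta>"
      by (simp add: algebra_simps)
    also have "real (2 * Suc k) * \<theta> - 2 * \<theta> = real (2 * k) * \<theta>"
      by (simp add: algebra_simps)
    finally show ?thesis by simp
  qed
  ultimately show ?case by blast
qed

text \<open>Through \<open>cos (2 * k * \<theta>) = 1 - 2 * (sin (k * \<theta>))^2\<close> this
  bounds the Dirichlet kernel from below near its peak.\<close>

lemma abs_sin_nat_mult_le: "\<bar>sin (real k * x)\<bar> \<le> real k * \<bar>sin x\<bar>"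
proof (induction k)
  case (Suc k)
  have "\<bar>sin (real (Suc k) * x)\<bar> = \<bar>sin (real k * x) * cos x + cos (real k * x) * sin x\<bar>"
    using sin_add [of "real k * x" x] by (simp add: algebra_simps)
  also have "\<dots> \<le> \<bar>sin (real k * x)\<bar> * \<bar>cos x\<bar> + \<bar>cos (real k * x)\<bar> * \<bar>sin x\<bar>"
    by (metis abs_mult abs_triangle_ineq)
  also have "\<dots> \<le> \<bar>sin (real k * x)\<bar> * 1 + 1 * \<bar>sin x\<bar>"
    by (intro add_mono mult_mono) auto
  finally show ?case using Suc by (simp add: algebra_simps)
qed simp

text \<open>The polynomial is the normalised Dirichlet kernel of order \<open>n\<close> at \<open>2 * arcsin v\<close>.\<close>

lemma dirichlet_poly:
  "\<exists>p :: real poly. degree p \<le> 2 * n \<and>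
     (\<forall>v. \<bar>v\<bar> \<le> 1 \<longrightarrow> \<bar>poly p v\<bar> \<le> 1 \<and> (2 * real n + 1) * \<bar>v\<bar> * \<bar>poly p v\<bar> \<le> 1
         \<and> 1 - 2 * (real n)\<^sup>2 * v\<^sup>2 \<le> poly p v)"
proof -
  obtain c :: "nat \<Rightarrow> real poly"
    where deg: "\<And>k. degree (c k) \<le> 2 * k"
      and c: "\<And>k \<theta>. poly (c k) (sin \<theta>) = cos (real (2 * k) * \<theta>)"
    using cos_even_multiple_poly by metis
  let ?N = "2 * real n + 1"
  define p where "p = smult (1 / ?N) (1 + smult 2 (\<Sum>k=1..n. c k))"
  have "degree (\<Sum>k=1..n. c k) \<le> 2 * n"
    by (rule degree_sum_le) (auto intro: order_trans [OF deg])
  then have degp: "degree p \<le> 2 * n"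
    unfolding p_def by (intro order_trans [OF degree_smult_le] degree_add_le) auto
  have main: "\<bar>poly p v\<bar> \<le> 1 \<and> ?N * \<bar>v\<bar> * \<bar>poly p v\<bar> \<le> 1 \<and> 1 - 2 * (real n)\<^sup>2 * v\<^sup>2 \<le> poly p v"
    if "\<bar>v\<bar> \<le> 1" for v
  proof -
    define \<theta> where "\<theta> = arcsin v"
    have v: "v = sin \<theta>" using that by (simp add: \<theta>_def)
    let ?S = "\<Sum>k=1..n. cos (real (2 * k) * \<theta>)"
    have pv: "?N * poly p v = 1 + 2 * ?S"
      by (simp add: p_def v c poly_sum del: of_nat_mult)
    have S: "\<bar>?S\<bar> \<le> n"
      using sum_norm_bound [of "{1..n}" "\<lambda>k. cos (real (2 * k) * \<theta>)" 1] by simp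
    have "\<bar>?N * poly p v\<bar> \<le> ?N" unfolding pv using S by linarith
    then have 1: "\<bar>poly p v\<bar> \<le> 1" by (simp add: abs_mult)
    \<comment> \<open>The closed form of the Dirichlet kernel, by telescoping; bounding its right
      side by 1 gives the decay in \<open>v\<close>.\<close>
    have tele: "sin \<theta> * (1 + 2 * (\<Sum>k=1..m. cos (real (2 * k) * \<theta>))) = sin ((2 * real m + 1) * \<theta>)" for m
    proof (induction m)
      case (Suc m)
      have "2 * sin \<theta> * cos (real (2 * Suc m) * \<theta>) =
          sin (real (2 * Suc m) * \<theta> + \<theta>) - sin (real (2 * Suc m) * \<theta> - \<theta>)"
        by (simp add: sin_add sin_diff)
      also have "real (2 * Suc m) * \<theta> + \<theta> = (2 * real (Suc m) + 1) * \<theta>"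
        by (simp add: algebra_simps)
      also have "real (2 * Suc m) * \<theta> - \<theta> = (2 * real m + 1) * \<theta>"
        by (simp add: algebra_simps)
      finally show ?case using Suc by (simp add: algebra_simps)
    qed simp
    have "\<bar>v * (?N * poly p v)\<bar> \<le> 1" unfolding pv unfolding v tele by simp
    then have 2: "?N * \<bar>v\<bar> * \<bar>poly p v\<bar> \<le> 1" by (simp add: abs_mult mult_ac)
    have "cos (real (2 * k) * \<theta>) \<ge> 1 - 2 * (real n)\<^sup>2 * v\<^sup>2" if "k \<in> {1..n}" for k
    proof -
      have "\<bar>sin (real k * \<theta>)\<bar> \<le> real n * \<bar>sin \<theta>\<bar>"
        using abs_sin_nat_mult_le [of k \<theta>] that
        by (smt (verit) atLeastAtMost_iff mult_right_mono of_nat_mono)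
      then have "(sin (real k * \<theta>))\<^sup>2 \<le> (real n * \<bar>sin \<theta>\<bar>)\<^sup>2"
        using abs_le_square_iff by fastforce
      then have "(sin (real k * \<theta>))\<^sup>2 \<le> (real n)\<^sup>2 * v\<^sup>2"
        by (simp add: v power_mult_distrib)
      moreover have "cos (real (2 * k) * \<theta>) = 1 - 2 * (sin (real k * \<theta>))\<^sup>2"
        using cos_double_sin [of "real k * \<theta>"] by (simp add: mult.assoc)
      ultimately show ?thesis by linarith
    qed
    then have "?S \<ge> (\<Sum>k=1..n. 1 - 2 * (real n)\<^sup>2 * v\<^sup>2)" by (rule sum_mono)
    then have "?N * poly p v \<ge> 1 + 2 * (real n * (1 - 2 * (real n)\<^sup>2 * v\<^sup>2))"
      unfolding pv by simp
    also have "1 + 2 * (real n * (1 - 2 * (real n)\<^sup>2 * v\<^sup>2)) =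
        ?N * (1 - 2 * (real n)\<^sup>2 * v\<^sup>2) + 2 * (real n)\<^sup>2 * v\<^sup>2"
      by (simp add: algebra_simps)
    finally have "?N * (1 - 2 * (real n)\<^sup>2 * v\<^sup>2) \<le> ?N * poly p v"
      by (smt (verit) mult_nonneg_nonneg zero_le_power2)
    then have 3: "1 - 2 * (real n)\<^sup>2 * v\<^sup>2 \<le> poly p v"
      by (subst (asm) mult_le_cancel_left_pos) auto
    from 1 2 3 show ?thesis by blast
  qed
  show ?thesis using degp main by blast
qed

text \<open>Scaling by \<open>1 / (2 * B)\<close> brings the range of \<open>y\<close> into the unit
  interval. The even power makes the kernel nonnegative, and \<open>2 * m\<close> decaying factors
  outweigh a growth of order at most \<open>m\<close>. Normalisation costs only a factor of order
  \<open>m / \<delta>\<close>, because the unnormalised kernel stays above \<open>1 / 2\<close> on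
  an interval of length of order \<open>\<delta> / m\<close>.\<close>

lemma concentrated_poly_kernel:
  fixes B \<delta> :: real and m :: nat
  assumes "B \<ge> 1" "0 < \<delta>" "\<delta> \<le> 1" "m > 0"
  shows "\<exists>J :: real poly. real (degree J) \<le> 20 * B * real m / \<delta> \<and>
    (\<forall>y. 0 \<le> poly J y) \<and> integral {-2*B..2*B} (poly J) = 1 \<and>
    (\<forall>y j. \<delta> / 2 \<le> \<bar>y\<bar> \<longrightarrow> \<bar>y\<bar> \<le> 2 * B \<longrightarrow> j \<le> m \<longrightarrow>
      (\<bar>y\<bar> / \<delta>) ^ j * poly J y \<le> 10 * real m / \<delta> / 4 ^ m)"
proof -
  \<comment> \<open>Chosen so that the decay of the Dirichlet kernel reads
    \<open>1 / (4 * u)\<close> with \<open>u = \<bar>y\<bar> / \<delta>\<close>.\<close>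
  define n where "n = nat \<lceil>4 * B / \<delta>\<rceil>"
  have q1: "1 \<le> B / \<delta>" using assms by (simp add: field_simps)
  have n1: "4 * B / \<delta> \<le> real n" unfolding n_def by linarith
  have n2: "real n \<le> 5 * B / \<delta>"
  proof -
    have "real n \<le> 4 * B / \<delta> + 1" unfolding n_def using q1 by linarith
    also have "\<dots> \<le> 4 * B / \<delta> + B / \<delta>" using q1 by linarith
    also have "\<dots> = 5 * B / \<delta>" using assms by (simp add: field_simps)
    finally show ?thesis .
  qed
  have n0: "real n > 0" using n1 q1 by simp
  obtain p :: "real poly" where degp: "degree p \<le> 2 * n"
    and p1: "\<And>v. \<bar>v\<bar> \<le> 1 \<Longrightarrow> \<bar>poly p v\<bar> \<le> 1"
    and p2: "\<And>v. \<bar>v\<bar> \<le> 1 \<Longrightarrow> (2 * real n + 1) * \<bar>v\<bar> * \<bar>poly p v\<bar> \<le> 1"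
    and p3: "\<And>v. \<bar>v\<bar> \<le> 1 \<Longrightarrow> 1 - 2 * (real n)\<^sup>2 * v\<^sup>2 \<le> poly p v"
    using dirichlet_poly [of n] by blast
  define J0 where "J0 = (p \<circ>\<^sub>p [:0, 1 / (2 * B):]) ^ (2 * m)"
  have J0: "poly J0 y = poly p (y / (2 * B)) ^ (2 * m)" for y
    by (simp add: J0_def poly_pcompose)
  have cont: "continuous_on X (poly J0)" for X by (intro continuous_intros)
  have int: "poly J0 integrable_on {a..b}" for a b
    by (intro integrable_continuous_real cont)
  have nonneg: "0 \<le> poly J0 y" for y by (simp add: J0)
  \<comment> \<open>For \<open>\<bar>y\<bar> \<le> h\<close> the quadratic lower bound loses at most
    \<open>1 / (8 * m^2)\<close>, little enough for Bernoulli's inequality to keep the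
    \<open>2 * m\<close>-th power above \<open>1 / 2\<close>.\<close>
  define h where "h = B / (2 * real n * real m)"
  have h0: "h > 0" using assms n0 by (simp add: h_def)
  have "real n \<ge> 1" "real m \<ge> 1" using n0 assms by simp_all
  then have "2 * real n * real m \<ge> 1" by (metis mult_mono' mult_1 one_le_numeral zero_le_one mult_1_right order_trans)
  then have "h \<le> B / 1" unfolding h_def using assms n0 by (intro divide_left_mono) auto
  then have hB: "h \<le> 2 * B" using assms by simp
  have hd: "h \<ge> \<delta> / (10 * real m)"
  proof -
    have "real n * \<delta> \<le> 5 * B" using n2 assms by (simp add: field_simps)
    then have "\<delta> / (10 * real m) \<le> B / (2 * real n * real m)"
      using assms n0 by (simp add: field_simps)
    then show ?thesis by (simp add: h_def)
  qed
  have half: "1 / 2 \<le> poly J0 y" if "y \<in> {-h..h}" for y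
  proof -
    let ?z = "2 * (real n)\<^sup>2 * (y / (2 * B))\<^sup>2"
    have yh: "\<bar>y\<bar> \<le> h" using that by auto
    then have v1: "\<bar>y / (2 * B)\<bar> \<le> 1" using hB assms by (simp add: field_simps)
    have "y\<^sup>2 \<le> h\<^sup>2" using yh by (meson abs_le_square_iff abs_of_pos h0 order.trans abs_ge_self)
    then have "?z \<le> 2 * (real n)\<^sup>2 * (h\<^sup>2 / (2 * B)\<^sup>2)"
      unfolding power_divide by (intro mult_left_mono divide_right_mono) auto
    also have "\<dots> = 1 / (8 * (real m)\<^sup>2)"
      using assms n0 by (simp add: h_def power2_eq_square field_simps)
    also have "\<dots> \<le> 1 / (8 * real m)"
      using \<open>real m \<ge> 1\<close> assms by (intro divide_left_mono) (auto simp: power2_eq_square)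
    finally have z: "?z \<le> 1 / (8 * real m)" .
    have "1 / (8 * real m) \<le> 1 / 8" using \<open>real m \<ge> 1\<close> by (simp add: field_simps)
    with z have z1: "?z \<le> 1" by linarith
    have "real (2 * m) * ?z \<le> real (2 * m) * (1 / (8 * real m))"
      by (intro mult_left_mono z) auto
    also have "\<dots> \<le> 1 / 2" using assms by simp
    finally have "1 / 2 \<le> 1 + real (2 * m) * (- ?z)" by linarith
    also have "\<dots> \<le> (1 + (- ?z)) ^ (2 * m)"
      using z1 by (intro Bernoulli_inequality) linarith
    also have "\<dots> \<le> poly p (y / (2 * B)) ^ (2 * m)"
      using p3 [OF v1] z1 by (intro power_mono) linarith+
    finally show ?thesis by (simp add: J0)
  qed
  define I where "I = integral {-2*B..2*B} (poly J0)"
  have "h = integral {-h..h} (\<lambda>_. 1 / 2)" using h0 by simp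
  also have "\<dots> \<le> integral {-h..h} (poly J0)"
    by (intro integral_le int half) auto
  also have "\<dots> \<le> I" unfolding I_def
    using hB by (intro integral_subset_le int) (auto intro: nonneg)
  finally have Ih: "h \<le> I" .
  then have I0: "I > 0" using h0 by linarith
  have invI: "1 / I \<le> 10 * real m / \<delta>"
  proof -
    have "1 / I \<le> 1 / (\<delta> / (10 * real m))"
      using Ih hd assms h0 I0 by (intro divide_left_mono) auto
    then show ?thesis by simp
  qed
  define J where "J = smult (1 / I) J0"
  have J: "poly J = (\<lambda>y. 1 / I * poly J0 y)" by (auto simp: J_def)
  have "degree J0 \<le> degree p * (2 * m)"
    unfolding J0_def by (intro order_trans [OF degree_power_le]) (simp add: degree_pcompose)
  also have "\<dots> \<le> (2 * n) * (2 * m)" by (intro mult_right_mono degp) auto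
  finally have "degree J \<le> 4 * n * m"
    unfolding J_def using degree_smult_le [of "1 / I" J0] by linarith
  then have "real (degree J) \<le> 4 * real n * real m"
    by (metis of_nat_mono of_nat_mult of_nat_numeral)
  also have "\<dots> \<le> 4 * (5 * B / \<delta>) * real m" using assms by (intro mult_mono n2) auto
  finally have 1: "real (degree J) \<le> 20 * B * real m / \<delta>" by simp
  have 2: "0 \<le> poly J y" for y using nonneg I0 by (simp add: J)
  have 3: "integral {-2*B..2*B} (poly J) = 1"
    unfolding J integral_mult_right using I0 by (simp add: I_def)
  have 4: "(\<bar>y\<bar> / \<delta>) ^ j * poly J y \<le> 10 * real m / \<delta> / 4 ^ m"
    if y: "\<delta> / 2 \<le> \<bar>y\<bar>" "\<bar>y\<bar> \<le> 2 * B" and j: "j \<le> m" for y j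
  proof -
    define u where "u = \<bar>y\<bar> / \<delta>"
    have u: "u \<ge> 1 / 2" using y assms by (simp add: u_def field_simps)
    let ?P = "\<bar>poly p (y / (2 * B))\<bar>"
    have v1: "\<bar>y / (2 * B)\<bar> \<le> 1" using y assms by (simp add: field_simps)
    have "4 * u * ?P \<le> (2 * real n + 1) * \<bar>y / (2 * B)\<bar> * ?P"
    proof (intro mult_right_mono)
      have "4 * u = (2 * (4 * B / \<delta>)) * \<bar>y / (2 * B)\<bar>"
        using assms by (simp add: u_def abs_mult field_simps)
      also have "\<dots> \<le> (2 * real n + 1) * \<bar>y / (2 * B)\<bar>"
        using n1 by (intro mult_right_mono) auto
      finally show "4 * u \<le> (2 * real n + 1) * \<bar>y / (2 * B)\<bar>" .
    qed auto
    also have "\<dots> \<le> 1" by (rule p2 [OF v1])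
    finally have P: "?P \<le> 1 / (4 * u)" using u by (simp add: field_simps)
    have "u ^ j * poly J0 y = u ^ j * ?P ^ (2 * m)" by (simp add: J0 power_mult)
    also have "\<dots> \<le> u ^ j * (1 / (4 * u)) ^ (2 * m)"
      using u by (intro mult_left_mono power_mono P) auto
    \<comment> \<open>The factor \<open>u ^ j\<close> cancels against part of the decay; since
      \<open>1 / u \<le> 2\<close>, what remains is at most \<open>4 ^ m / 16 ^ m\<close>.\<close>
    also have "\<dots> = (1 / u) ^ (2 * m - j) / 16 ^ m"
    proof -
      have "u ^ (2 * m) = u ^ j * u ^ (2 * m - j)"
        using j by (simp flip: power_add)
      moreover have "(4::real) ^ (2 * m) = 16 ^ m" by (simp add: power_mult)
      ultimately show ?thesis using u by (simp add: power_divide power_mult_distrib)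
    qed
    also have "\<dots> \<le> 2 ^ (2 * m - j) / 16 ^ m"
      using u by (intro divide_right_mono power_mono) (auto simp: field_simps)
    also have "\<dots> \<le> 2 ^ (2 * m) / 16 ^ m"
      by (intro divide_right_mono power_increasing) auto
    also have "\<dots> = 1 / 4 ^ m"
    proof -
      have "(16::real) ^ m = 4 ^ m * 4 ^ m" by (simp flip: power_mult_distrib)
      then show ?thesis by (simp add: power_mult)
    qed
    finally have "u ^ j * poly J0 y \<le> 1 / 4 ^ m" .
    then have "1 / I * (u ^ j * poly J0 y) \<le> (10 * real m / \<delta>) * (1 / 4 ^ m)"
      using invI I0 u nonneg assms by (intro mult_mono) auto
    then show ?thesis by (simp add: J u_def mult_ac)
  qed
  show ?thesis using 1 2 3 4 by blast
qed

section \<open>Integrals of polynomials depending on a parameter\<close>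

text \<open>Coefficientwise continuity needs no topology on polynomials, and it is preserved by the
  operations from which the integrand of \<open>q\<close> is built.\<close>

definition cont_coeffs :: "real set \<Rightarrow> (real \<Rightarrow> complex poly) \<Rightarrow> bool" where
  "cont_coeffs S p \<longleftrightarrow> (\<forall>i. continuous_on S (\<lambda>t. coeff (p t) i))"

lemma cont_coeffs_const: "cont_coeffs S (\<lambda>_. p)"
  by (simp add: cont_coeffs_def)

lemma cont_coeffs_pCons:
  "continuous_on S c \<Longrightarrow> cont_coeffs S p \<Longrightarrow> cont_coeffs S (\<lambda>t. pCons (c t) (p t))"
  unfolding cont_coeffs_def
proof
  fix i
  assume "continuous_on S c" "\<forall>i. continuous_on S (\<lambda>t. coeff (p t) i)"
  then show "continuous_on S (\<lambda>t. coeff (pCons (c t) (p t)) i)"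
    by (cases i) auto
qed

lemma cont_coeffs_add:
  "cont_coeffs S p \<Longrightarrow> cont_coeffs S q \<Longrightarrow> cont_coeffs S (\<lambda>t. p t + q t)"
  by (auto simp: cont_coeffs_def intro!: continuous_intros)

lemma cont_coeffs_smult:
  "continuous_on S c \<Longrightarrow> cont_coeffs S p \<Longrightarrow> cont_coeffs S (\<lambda>t. smult (c t) (p t))"
  by (auto simp: cont_coeffs_def intro!: continuous_intros)

lemma cont_coeffs_mult:
  "cont_coeffs S p \<Longrightarrow> cont_coeffs S q \<Longrightarrow> cont_coeffs S (\<lambda>t. p t * q t)"
  by (auto simp: cont_coeffs_def coeff_mult intro!: continuous_intros)

lemma cont_coeffs_power: "cont_coeffs S p \<Longrightarrow> cont_coeffs S (\<lambda>t. p t ^ n)"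
  by (induction n) (auto intro: cont_coeffs_const cont_coeffs_mult)

lemma cont_coeffs_sum:
  "(\<And>j. j \<in> A \<Longrightarrow> cont_coeffs S (p j)) \<Longrightarrow> cont_coeffs S (\<lambda>t. \<Sum>j\<in>A. p j t)"
  by (auto simp: cont_coeffs_def coeff_sum intro!: continuous_intros)

lemma cont_coeffs_pcompose: "cont_coeffs S p \<Longrightarrow> cont_coeffs S (\<lambda>t. q \<circ>\<^sub>p p t)"
  by (induction q)
    (auto simp: pcompose_pCons intro!: cont_coeffs_const cont_coeffs_add cont_coeffs_mult)

text \<open>Integrate coefficient by coefficient. The degree bound is uniform in \<open>t\<close>,
  so the same finite sum represents every \<open>p t\<close>.\<close>

lemma integral_poly_param:
  assumes cont: "cont_coeffs {a..b} p" and deg: "\<And>t. degree (p t) \<le> N"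
  shows "\<exists>q :: complex poly. degree q \<le> N \<and>
    (\<forall>x. ((\<lambda>t. poly (p t) x) has_integral poly q x) {a..b})"
proof -
  define q where "q = (\<Sum>i\<le>N. monom (integral {a..b} (\<lambda>t. coeff (p t) i)) i)"
  have "degree q \<le> N" unfolding q_def
    by (intro degree_sum_le) (auto intro: order_trans [OF degree_monom_le])
  moreover have "((\<lambda>t. poly (p t) x) has_integral poly q x) {a..b}" for x
  proof -
    have "poly (p t) x = (\<Sum>i\<le>N. coeff (p t) i * x ^ i)" for t
      unfolding poly_altdef
      by (rule sum.mono_neutral_left) (use deg in \<open>auto simp: coeff_eq_0 intro: order_trans\<close>)
    moreover have "((\<lambda>t. \<Sum>i\<le>N. coeff (p t) i * x ^ i) has_integral
        (\<Sum>i\<le>N. integral {a..b} (\<lambda>t. coeff (p t) i) * x ^ i)) {a..b}"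
      using cont unfolding cont_coeffs_def
      by (intro has_integral_sum has_integral_mult_left integrable_integral
          integrable_continuous_real) auto
    ultimately show ?thesis by (simp add: q_def poly_sum poly_monom)
  qed
  ultimately show ?thesis by blast
qed

section \<open>Averaging Taylor polynomials against the kernel\<close>

text \<open>Cauchy's inequality on the circle of radius \<open>\<delta>\<close> about
  \<open>z\<close>.\<close>

lemma taylor_coeff_bound:
  assumes "F holomorphic_on W" "cball z \<delta> \<subseteq> W" "\<delta> > 0" "\<And>w. w \<in> W \<Longrightarrow> norm (F w) \<le> M"
  shows "norm ((deriv ^^ j) F z / fact j) \<le> M / \<delta> ^ j"
proof -
  have hol: "F holomorphic_on cball z \<delta>" using assms holomorphic_on_subset by blast
  have "norm ((deriv ^^ j) F z) \<le> fact j * M / \<delta> ^ j"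
  proof (rule Cauchy_inequality)
    show "F holomorphic_on ball z \<delta>" using hol by (rule holomorphic_on_subset) auto
    show "continuous_on (cball z \<delta>) F" using hol by (rule holomorphic_on_imp_continuous_on)
    show "norm (F w) \<le> M" if "norm (z - w) = \<delta>" for w
      using that assms by (intro assms(4)) (auto simp: dist_norm subset_iff)
  qed fact
  then show ?thesis by (simp add: norm_divide field_simps)
qed

text \<open>At half the radius the \<open>j\<close>-th Taylor term is at most
  \<open>M / 2 ^ j\<close>, so the tail is dominated by a geometric series.\<close>

lemma taylor_remainder_bound:
  assumes "F holomorphic_on W" "cball z \<delta> \<subseteq> W" "\<delta> > 0" "\<And>w. w \<in> W \<Longrightarrow> norm (F w) \<le> M"
    and w: "norm (w - z) \<le> \<delta> / 2"
  shows "norm ((\<Sum>j<m. (deriv ^^ j) F z / fact j * (w - z) ^ j) - F w) \<le> 2 * M / 2 ^ m"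
proof -
  let ?a = "\<lambda>j. (deriv ^^ j) F z / fact j * (w - z) ^ j"
  have "?a sums F w"
  proof (rule holomorphic_power_series)
    show "F holomorphic_on ball z \<delta>"
      using assms ball_subset_cball holomorphic_on_subset by blast
    show "w \<in> ball z \<delta>" using w \<open>\<delta> > 0\<close> by (simp add: dist_norm norm_minus_commute)
  qed
  then have 1: "(\<lambda>n. ?a (n + m)) sums (F w - (\<Sum>j<m. ?a j))"
    by (rule sums_split_initial_segment)
  have M: "M \<ge> 0" using assms by (smt (verit) centre_in_cball norm_ge_zero subsetD)
  have "norm (?a (n + m)) \<le> M / 2 ^ m * (1 / 2) ^ n" for n
  proof -
    have "norm (?a (n + m)) \<le> M / \<delta> ^ (n + m) * (\<delta> / 2) ^ (n + m)"
      unfolding norm_mult norm_power using w M \<open>\<delta> > 0\<close>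
      by (intro mult_mono power_mono taylor_coeff_bound [OF assms(1-4)]) auto
    also have "\<dots> = M / 2 ^ m * (1 / 2) ^ n"
      using \<open>\<delta> > 0\<close> by (simp add: power_divide power_add)
    finally show ?thesis .
  qed
  moreover have "(\<lambda>n. M / 2 ^ m * (1 / 2) ^ n) sums (M / 2 ^ m * 2)"
    using geometric_sums [of "1 / 2 :: real"] by (intro sums_mult) simp
  ultimately have "norm (F w - (\<Sum>j<m. ?a j)) \<le> M / 2 ^ m * 2"
    using norm_sums_le [OF 1] by blast
  then show ?thesis by (simp add: norm_minus_commute mult.commute)
qed

lemma poly_map_poly_of_real:
  "poly (map_poly of_real p) (of_real x :: 'a :: {real_algebra_1, comm_ring_1}) = of_real (poly p x)"
  by (induction p) (auto simp: map_poly_pCons)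

text \<open>In \<open>E\<close> the summand \<open>2 / 2 ^ m\<close> is the Taylor remainder. The
  other one is the kernel tail multiplied by bounds for the number of terms and the length of
  integration. With \<open>B \<ge> 2\<close> all differences \<open>t - x\<close> stay within
  \<open>2 * B\<close>, where the kernel is controlled.\<close>

lemma localized_taylor_kernel_approx:
  fixes F :: "complex \<Rightarrow> complex" and B \<delta> M :: real and m :: nat
  assumes "open W" and hol: "F holomorphic_on W" and bd: "\<And>z. z \<in> W \<Longrightarrow> norm (F z) \<le> M"
    and \<delta>: "0 < \<delta>" "\<delta> \<le> 1" and B: "B \<ge> 2" and m: "m > 0"
    and sub: "\<And>t. \<bar>t\<bar> \<le> 1 + \<delta> \<Longrightarrow> cball (complex_of_real t) \<delta> \<subseteq> W"
  defines "E \<equiv> 2 / 2 ^ m + 8 * B * (real m + 1) * (10 * real m / \<delta> / 4 ^ m)"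
  shows "\<exists>q :: complex poly. real (degree q) \<le> 21 * B * real m / \<delta> \<and>
    (\<forall>x. \<bar>x\<bar> \<le> 1 \<longrightarrow> norm (F (of_real x) - poly q (of_real x)) \<le> M * E) \<and>
    (\<forall>x. \<bar>x\<bar> \<le> 1 + \<delta> \<longrightarrow> norm (poly q (of_real x)) \<le> M * (1 + E)) \<and>
    (\<forall>x. 1 + \<delta> \<le> \<bar>x\<bar> \<longrightarrow> \<bar>x\<bar> \<le> B \<longrightarrow> norm (poly q (of_real x)) \<le> M * E)"
proof -
  define \<tau> where "\<tau> = 10 * real m / \<delta> / 4 ^ m"
  have \<tau>: "\<tau> \<ge> 0" using \<delta> by (simp add: \<tau>_def)
  obtain J :: "real poly" where degJ: "real (degree J) \<le> 20 * B * real m / \<delta>"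
    and J0: "\<And>y. 0 \<le> poly J y" and J1: "integral {-2*B..2*B} (poly J) = 1"
    and Jfar: "\<And>y j. \<delta> / 2 \<le> \<bar>y\<bar> \<Longrightarrow> \<bar>y\<bar> \<le> 2 * B \<Longrightarrow> j \<le> m \<Longrightarrow> (\<bar>y\<bar> / \<delta>) ^ j * poly J y \<le> \<tau>"
    using concentrated_poly_kernel [of B \<delta> m] \<delta> B m unfolding \<tau>_def by (auto simp: Ball_def)
  \<comment> \<open>Halfway between \<open>1\<close> and \<open>1 + \<delta>\<close>: the endpoints
    \<open>-s\<close> and \<open>s\<close> keep distance at least \<open>\<delta> / 2\<close> both
    from \<open>[-1,1]\<close> and from the points with
    \<open>\<bar>x\<bar> \<ge> 1 + \<delta>\<close>.\<close>
  define s where "s = 1 + \<delta> / 2"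
  have s: "1 < s" "s < 1 + \<delta>" "s \<le> 2" using \<delta> by (auto simp: s_def)
  have M: "M \<ge> 0"
    using bd [of 0] sub [of 0] \<delta> by (smt (verit) centre_in_cball norm_ge_zero subsetD of_real_0)
  define a where "a = (\<lambda>j t. (deriv ^^ j) F (complex_of_real t) / fact j)"
  define P where "P = (\<lambda>t x. \<Sum>j<m. a j t * complex_of_real (x - t) ^ j)"
  \<comment> \<open>The integrand as a polynomial in \<open>x\<close>, with \<open>t\<close> as
    parameter; composing with \<open>[:t, -1:]\<close> yields \<open>J (t - x)\<close>.\<close>
  define p where "p = (\<lambda>t. (\<Sum>j<m. smult (a j t) ([:- complex_of_real t, 1:] ^ j)) *
      (map_poly of_real J \<circ>\<^sub>p [:complex_of_real t, -1:]))"
  have contp: "cont_coeffs {-s..s} p"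
  proof -
    have "continuous_on {-s..s} (a j)" for j
    proof -
      have c1: "continuous_on W ((deriv ^^ j) F)"
        using hol \<open>open W\<close> by (intro holomorphic_on_imp_continuous_on holomorphic_higher_deriv)
      have c2: "complex_of_real ` {-s..s} \<subseteq> W"
      proof
        fix z assume "z \<in> complex_of_real ` {-s..s}"
        then obtain t where "z = of_real t" "\<bar>t\<bar> \<le> 1 + \<delta>" using s by force
        then show "z \<in> W" using sub [of t] \<delta> by auto
      qed
      have "continuous_on {-s..s} (\<lambda>t. (deriv ^^ j) F (complex_of_real t))"
        by (rule continuous_on_compose2 [OF c1 _ c2]) (intro continuous_intros)
      then show ?thesis unfolding a_def by (intro continuous_on_divide continuous_on_const) auto
    qed
    note a = this
    show ?thesis unfolding p_def
      by (intro cont_coeffs_mult cont_coeffs_sum cont_coeffs_smult cont_coeffs_power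
          cont_coeffs_pcompose cont_coeffs_pCons cont_coeffs_const a continuous_intros)
  qed
  have degp: "degree (p t) \<le> m + degree J" for t
  proof -
    have "degree (smult (a j t) ([:- complex_of_real t, 1:] ^ j)) \<le> m" if "j \<in> {..<m}" for j
    proof -
      have "degree ([:- complex_of_real t, 1:] ^ j) \<le> 1 * j"
        using degree_power_le [of "[:- complex_of_real t, 1:]" j] by simp
      then show ?thesis
        using that degree_smult_le [of "a j t" "[:- complex_of_real t, 1:] ^ j"] by simp
    qed
    then have "degree (\<Sum>j<m. smult (a j t) ([:- complex_of_real t, 1:] ^ j)) \<le> m"
      by (intro degree_sum_le) auto
    moreover have "degree (map_poly of_real J \<circ>\<^sub>p [:complex_of_real t, -1:]) \<le> degree J"
      by (simp add: degree_pcompose degree_map_poly)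
    ultimately show ?thesis unfolding p_def
      by (intro order_trans [OF degree_mult_le] add_mono)
  qed
  have polyp: "poly (p t) (of_real x) = P t x * of_real (poly J (t - x))" for t x
  proof -
    have "poly (map_poly of_real J \<circ>\<^sub>p [:complex_of_real t, -1:]) (of_real x) = of_real (poly J (t - x))"
      using poly_map_poly_of_real [of J "t - x", where 'a = complex] by (simp add: poly_pcompose)
    then show ?thesis by (simp add: p_def P_def poly_sum)
  qed
  obtain q where degq: "degree q \<le> m + degree J"
    and q: "\<And>x. ((\<lambda>t. poly (p t) x) has_integral poly q x) {-s..s}"
    using integral_poly_param [OF contp degp] by blast
  have qint: "((\<lambda>t. P t x * of_real (poly J (t - x))) has_integral poly q (of_real x)) {-s..s}" for x
    using q [of "of_real x"] by (simp add: polyp)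
  have "real (degree q) \<le> real m + real (degree J)" using degq by linarith
  also have "real m \<le> B * real m / \<delta>"
  proof -
    have "real m * \<delta> \<le> real m * B" using \<delta> B by (intro mult_left_mono) auto
    then show ?thesis using \<delta> by (simp add: field_simps)
  qed
  also have "B * real m / \<delta> + real (degree J) \<le> 21 * B * real m / \<delta>"
    using degJ by simp
  finally have deg: "real (degree q) \<le> 21 * B * real m / \<delta>" by simp

  have intJ: "poly J integrable_on {u..v}" for u v
    by (intro integrable_continuous_real continuous_intros)
  have intJs: "(\<lambda>t. poly J (t - x)) integrable_on {u..v}" for u v x
    by (intro integrable_continuous_real continuous_intros)
  \<comment> \<open>Each of the \<open>m\<close> Taylor terms grows at most like
    \<open>M * (\<bar>t - x\<bar> / \<delta>) ^ j\<close>, which the kernel reduces to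
    \<open>M * \<tau>\<close>.\<close>
  have P_far: "norm (P t x * of_real (poly J (t - x))) \<le> M * real m * \<tau>"
    if t: "\<bar>t\<bar> \<le> s" and x: "\<bar>x\<bar> \<le> B" and far: "\<delta> / 2 \<le> \<bar>t - x\<bar>" for t x
  proof -
    have tB: "\<bar>t - x\<bar> \<le> 2 * B" using t x s B by linarith
    have "norm (P t x) \<le> (\<Sum>j<m. M * (\<bar>t - x\<bar> / \<delta>) ^ j)"
      unfolding P_def
    proof (rule sum_norm_le)
      fix j assume "j \<in> {..<m}"
      have "norm (a j t) \<le> M / \<delta> ^ j"
        unfolding a_def using t s
        by (intro taylor_coeff_bound [OF hol sub \<open>0 < \<delta>\<close> bd]) auto
      then have "norm (a j t) * \<bar>t - x\<bar> ^ j \<le> M / \<delta> ^ j * \<bar>t - x\<bar> ^ j"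
        by (rule mult_right_mono) simp
      then show "norm (a j t * complex_of_real (x - t) ^ j) \<le> M * (\<bar>t - x\<bar> / \<delta>) ^ j"
        by (simp add: norm_mult norm_power power_divide abs_minus_commute
            del: of_real_diff)
    qed
    then have "norm (P t x) * poly J (t - x) \<le> (\<Sum>j<m. M * (\<bar>t - x\<bar> / \<delta>) ^ j) * poly J (t - x)"
      by (rule mult_right_mono) (rule J0)
    also have "\<dots> = (\<Sum>j<m. M * ((\<bar>t - x\<bar> / \<delta>) ^ j * poly J (t - x)))"
      by (simp add: sum_distrib_right mult.assoc)
    also have "\<dots> \<le> (\<Sum>j<m. M * \<tau>)"
      by (intro sum_mono mult_left_mono Jfar far tB M) auto
    finally show ?thesis by (simp add: norm_mult J0 mult_ac)
  qed

  \<comment> \<open>A smooth cutoff. After a shift it is the kernel mass of a subinterval, to be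
    compared with the total mass 1.\<close>
  define R where "R = (\<lambda>x. integral {-s..s} (\<lambda>t. poly J (t - x)))"
  have R_shift: "R x = integral {- s - x..s - x} (poly J)" for x
    using integral_shift_Icc_real [of "-s" s "poly J" "-x"]
    by (simp add: R_def o_def add.commute [of "-x"])
  have R0: "0 \<le> R x" for x
    unfolding R_def by (intro integral_nonneg intJs J0)
  have R1: "R x \<le> 1" if "\<bar>x\<bar> \<le> B" for x
    unfolding R_shift J1 [symmetric] using that s B
    by (intro integral_subset_le intJ) (auto simp: J0)
  \<comment> \<open>The missing mass lies in two tails at distance at least
    \<open>\<delta> / 2\<close> from 0, where the case \<open>j = 0\<close> of \<open>Jfar\<close>
    bounds the kernel by \<open>\<tau>\<close>.\<close>
  have R_near: "1 - R x \<le> 4 * B * \<tau>" if "\<bar>x\<bar> \<le> 1" for x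
  proof -
    have J_le: "poly J y \<le> \<tau>" if "\<delta> / 2 \<le> \<bar>y\<bar>" "\<bar>y\<bar> \<le> 2 * B" for y
      using Jfar [OF that, of 0] by simp
    have le: "- s - x \<le> - \<delta> / 2" "\<delta> / 2 \<le> s - x" "- 2 * B \<le> - s - x" "s - x \<le> 2 * B"
      using that s B by (auto simp: s_def abs_le_iff)
    have "integral {-2*B..- s - x} (poly J) \<le> integral {-2*B..- s - x} (\<lambda>_. \<tau>)"
      by (intro integral_le intJ J_le) (use le \<delta> in auto)
    moreover have "integral {s - x..2*B} (poly J) \<le> integral {s - x..2*B} (\<lambda>_. \<tau>)"
      by (intro integral_le intJ J_le) (use le \<delta> in auto)
    moreover have "integral {-2*B..- s - x} (poly J) + (R x + integral {s - x..2*B} (poly J)) = 1"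
      unfolding R_shift J1 [symmetric] using le \<delta>
      by (simp add: Henstock_Kurzweil_Integration.integral_combine intJ)
    ultimately have "1 - R x \<le> (- s - x + 2 * B) * \<tau> + (2 * B - (s - x)) * \<tau>"
      using le by simp
    also have "\<dots> = (4 * B - 2 * s) * \<tau>" by (simp add: algebra_simps)
    also have "\<dots> \<le> 4 * B * \<tau>" using \<tau> s by (intro mult_right_mono) auto
    finally show ?thesis .
  qed

  \<comment> \<open>The error of \<open>q\<close> against \<open>F * R\<close>; replacing
    \<open>R\<close> by 1 on \<open>[-1,1]\<close> adds \<open>4 * B * \<tau>\<close>, and
    \<open>E\<close> covers the sum.\<close>
  define D where "D = 2 / 2 ^ m + 4 * (real m + 1) * \<tau>"
  have D0: "D \<ge> 0" using \<tau> by (simp add: D_def)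
  have "4 * (real m + 1) * \<tau> + 4 * B * \<tau> \<le> 8 * B * (real m + 1) * \<tau>"
  proof -
    have "2 * (real m + 1) \<le> B * (real m + 1)" "B * 1 \<le> B * (real m + 1)"
      using B by (intro mult_right_mono mult_left_mono; simp)+
    moreover have "0 \<le> B * (real m + 1)" using B by simp
    ultimately have "4 * (real m + 1) + 4 * B \<le> 8 * (B * (real m + 1))" by linarith
    then have "(4 * (real m + 1) + 4 * B) * \<tau> \<le> 8 * (B * (real m + 1)) * \<tau>"
      by (rule mult_right_mono) (rule \<tau>)
    then show ?thesis by (simp add: algebra_simps)
  qed
  then have E: "D + 4 * B * \<tau> \<le> E" unfolding E_def D_def \<tau>_def [symmetric] by linarith
  then have DE: "D \<le> E" using B \<tau> by (smt (verit) mult_nonneg_nonneg)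
  have main: "norm (poly q (of_real x) - F (of_real x) * of_real (R x)) \<le> M * D"
    if x: "\<bar>x\<bar> \<le> 1 + \<delta>" for x
  proof -
    have xB: "\<bar>x\<bar> \<le> B" using x \<delta> B by linarith
    have Fx: "norm (F (of_real x)) \<le> M"
      using sub [OF x] \<delta> by (intro bd) auto
    \<comment> \<open>One continuous majorant for both ranges of \<open>t\<close>: the first summand
      serves near \<open>x\<close>, the second far from it, with \<open>m\<close> Taylor terms and
      one term for \<open>F x\<close> itself.\<close>
    let ?g = "\<lambda>t. 2 * M / 2 ^ m * poly J (t - x) + M * (real m + 1) * \<tau>"
    let ?f = "\<lambda>t. P t x * of_real (poly J (t - x)) - F (of_real x) * of_real (poly J (t - x))"
    have "((\<lambda>t. complex_of_real (poly J (t - x))) has_integral of_real (R x)) {-s..s}"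
      unfolding R_def by (intro has_integral_of_real integrable_integral intJs)
    then have f: "(?f has_integral poly q (of_real x) - F (of_real x) * of_real (R x)) {-s..s}"
      by (intro has_integral_diff qint has_integral_mult_right)
    have "norm (integral {-s..s} ?f) \<le> integral {-s..s} ?g"
    proof (rule integral_norm_bound_integral)
      show "?f integrable_on {-s..s}" using f by blast
      show "?g integrable_on {-s..s}"
        by (intro integrable_continuous_real continuous_intros)
      fix t assume "t \<in> {-s..s}"
      then have t: "\<bar>t\<bar> \<le> s" by auto
      show "norm (?f t) \<le> ?g t"
      proof (cases "\<bar>t - x\<bar> \<le> \<delta> / 2")
        case True
        have "norm (P t x - F (of_real x)) \<le> 2 * M / 2 ^ m"
          unfolding P_def a_def of_real_diff
        proof (rule taylor_remainder_bound [OF hol sub \<open>0 < \<delta>\<close> bd])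
          show "norm (complex_of_real x - complex_of_real t) \<le> \<delta> / 2"
            using True by (metis norm_of_real of_real_diff abs_minus_commute)
        qed (use t s in auto)
        then have "norm (P t x - F (of_real x)) * poly J (t - x) \<le> 2 * M / 2 ^ m * poly J (t - x)"
          by (rule mult_right_mono) (rule J0)
        moreover have "norm (?f t) = norm (P t x - F (of_real x)) * poly J (t - x)"
          by (metis J0 abs_of_nonneg left_diff_distrib norm_mult norm_of_real)
        moreover have "0 \<le> M * (real m + 1) * \<tau>" using M \<tau> by simp
        ultimately show ?thesis by linarith
      next
        case False
        have "\<bar>t - x\<bar> \<le> 2 * B" using t xB s B by linarith
        then have "poly J (t - x) \<le> \<tau>" using Jfar [of "t - x" 0] False by simp
        then have "norm (F (of_real x) * of_real (poly J (t - x))) \<le> M * \<tau>"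
          using Fx J0 M by (simp add: norm_mult mult_mono)
        moreover have "norm (P t x * of_real (poly J (t - x))) \<le> M * real m * \<tau>"
          using False by (intro P_far t xB) auto
        ultimately have "norm (?f t) \<le> M * real m * \<tau> + M * \<tau>"
          using norm_triangle_ineq4 order_trans add_mono by meson
        moreover have "0 \<le> 2 * M / 2 ^ m * poly J (t - x)" using M J0 by simp
        ultimately show ?thesis by (simp add: algebra_simps)
      qed
    qed
    also have "integral {-s..s} ?g = 2 * M / 2 ^ m * R x + 2 * s * (M * (real m + 1) * \<tau>)"
    proof -
      have "(?g has_integral (2 * M / 2 ^ m * R x + (s - (- s)) *\<^sub>R (M * (real m + 1) * \<tau>))) {-s..s}"
        unfolding R_def using s
        by (intro has_integral_add has_integral_mult_right integrable_integral intJs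
            has_integral_const_real [THEN has_integral_eq_rhs]) auto
      then show ?thesis by (simp add: integral_unique)
    qed
    also have "\<dots> \<le> 2 * M / 2 ^ m * 1 + 4 * (M * (real m + 1) * \<tau>)"
      using M \<tau> s R1 [OF xB] by (intro add_mono mult_left_mono mult_right_mono) auto
    also have "\<dots> = M * D" by (simp add: D_def algebra_simps)
    finally show ?thesis using f by (simp add: integral_unique)
  qed
  have 1: "norm (F (of_real x) - poly q (of_real x)) \<le> M * E" if x: "\<bar>x\<bar> \<le> 1" for x
  proof -
    have x': "\<bar>x\<bar> \<le> 1 + \<delta>" "\<bar>x\<bar> \<le> B" using x \<delta> B by auto
    have Fx: "norm (F (of_real x)) \<le> M"
      using sub [OF x'(1)] \<delta> by (intro bd) auto
    have "F (of_real x) - poly q (of_real x) =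
        F (of_real x) * of_real (1 - R x) - (poly q (of_real x) - F (of_real x) * of_real (R x))"
      by (simp add: algebra_simps)
    also have "norm \<dots> \<le> norm (F (of_real x) * of_real (1 - R x)) +
        norm (poly q (of_real x) - F (of_real x) * of_real (R x))"
      by (rule norm_triangle_ineq4)
    also have "norm (F (of_real x) * of_real (1 - R x)) = norm (F (of_real x)) * (1 - R x)"
      using R1 [OF x'(2)] by (simp add: norm_mult del: of_real_diff)
    also have "\<dots> \<le> M * (4 * B * \<tau>)"
      using R1 [OF x'(2)] by (intro mult_mono Fx R_near [OF x] M) auto
    also have "M * (4 * B * \<tau>) + norm (poly q (of_real x) - F (of_real x) * of_real (R x))
        \<le> M * (4 * B * \<tau>) + M * D"
      using main [OF x'(1)] by simp
    also have "\<dots> = M * (D + 4 * B * \<tau>)" by (simp add: algebra_simps)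
    also have "\<dots> \<le> M * E" by (intro mult_left_mono E M)
    finally show ?thesis by simp
  qed
  have 2: "norm (poly q (of_real x)) \<le> M * (1 + E)" if x: "\<bar>x\<bar> \<le> 1 + \<delta>" for x
  proof -
    have xB: "\<bar>x\<bar> \<le> B" using x \<delta> B by linarith
    have "norm (F (of_real x)) * R x \<le> M * 1"
      using sub [OF x] \<delta> R0 R1 [OF xB] M by (intro mult_mono bd) auto
    moreover have "norm (poly q (of_real x)) \<le>
        norm (poly q (of_real x) - F (of_real x) * of_real (R x)) + norm (F (of_real x) * of_real (R x))"
      by (metis diff_add_cancel norm_triangle_ineq)
    moreover have "M * D \<le> M * E" by (intro mult_left_mono DE M)
    ultimately show ?thesis
      using main [OF x] R0 [of x] by (simp add: norm_mult algebra_simps)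
  qed
  \<comment> \<open>Every \<open>t\<close> in the range of integration is now at distance at least
    \<open>\<delta> / 2\<close> from \<open>x\<close>, so \<open>P_far\<close> bounds the whole
    integrand.\<close>
  have 3: "norm (poly q (of_real x)) \<le> M * E" if x: "1 + \<delta> \<le> \<bar>x\<bar>" "\<bar>x\<bar> \<le> B" for x
  proof -
    have "norm (poly q (of_real x)) \<le> (M * real m * \<tau>) * measure lborel (cbox (-s) s)"
    proof (rule has_integral_bound)
      show "((\<lambda>t. P t x * of_real (poly J (t - x))) has_integral poly q (of_real x)) (cbox (-s) s)"
        using qint by simp
      fix t assume "t \<in> cbox (-s) s"
      then have t: "\<bar>t\<bar> \<le> s" by auto
      then have "\<delta> / 2 \<le> \<bar>t - x\<bar>" using x s_def by linarith
      then show "norm (P t x * of_real (poly J (t - x))) \<le> M * real m * \<tau>"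
        by (intro P_far t x)
    qed (use M \<tau> in auto)
    also have "\<dots> = 2 * s * (M * real m * \<tau>)" using s by simp
    also have "\<dots> \<le> 4 * (M * real m * \<tau>)"
      using s M \<tau> by (intro mult_right_mono) auto
    also have "\<dots> = M * (4 * real m * \<tau>)" by simp
    also have "\<dots> \<le> M * D"
      using \<tau> by (intro mult_left_mono M) (simp add: D_def algebra_simps add_nonneg_nonneg)
    also have "\<dots> \<le> M * E" by (intro mult_left_mono DE M)
    finally show ?thesis .
  qed
  show ?thesis using deg 1 2 3 by blast
qed

section \<open>Choice of the parameters\<close>

text \<open>With \<open>X = b / (\<delta> * \<epsilon>) \<ge> 8\<close>, the choice
  \<open>m \<ge> 10 * ln X\<close> gives \<open>2 ^ m \<ge> X ^ 5 \<ge> 4096 * X\<close>. One factor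
  \<open>2 ^ m\<close> of \<open>4 ^ m\<close> absorbs \<open>(m + 1) * m\<close>, the other beats
  \<open>b / \<delta>\<close> and \<open>1 / \<epsilon>\<close>. The leading factor 2 leaves room
  for the later rescaling of the polynomial.\<close>

lemma truncation_order_exists:
  fixes b \<delta> \<epsilon> :: real
  assumes "0 < \<delta>" "\<delta> < 1 / 8" "0 < \<epsilon>" "\<epsilon> < 1" "b > 1"
  shows "\<exists>m>0. real m \<le> 11 * ln (b / (\<delta> * \<epsilon>)) \<and>
    2 * (2 / 2 ^ m + 8 * (2 * b) * (real m + 1) * (10 * real m / \<delta> / 4 ^ m)) \<le> \<epsilon>"
proof -
  define X where "X = b / (\<delta> * \<epsilon>)"
  define L where "L = ln X"
  define m where "m = nat \<lceil>10 * L\<rceil>"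
  have "\<delta> * \<epsilon> \<le> 1 / 8 * 1" using assms by (intro mult_mono) auto
  then have X8: "X \<ge> 8" using assms by (simp add: X_def field_simps)
  have "exp 1 \<le> X" using exp_le X8 by linarith
  then have L1: "L \<ge> 1" unfolding L_def using X8 by (subst ln_ge_iff) auto
  have m1: "10 * L \<le> real m" "real m \<le> 11 * L" "m > 0" using L1 unfolding m_def by linarith+
  have "exp (1 / 2) * exp (1 / 2) \<le> (2 * 2 :: real)"
    using exp_le by (simp flip: exp_add)
  then have e2: "exp (1 / 2) \<le> (2 :: real)"
    using power2_le_imp_le [of "exp (1 / 2)" 2] by (simp add: power2_eq_square)
  have "X ^ 4 \<ge> 8 ^ 4" using X8 by (intro power_mono) auto
  then have "4096 * X \<le> X ^ 4 * X" using X8 by (intro mult_right_mono) auto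
  also have "\<dots> = exp L ^ 5" using X8 by (simp add: L_def eval_nat_numeral)
  also have "\<dots> = exp (5 * L)" by (simp flip: exp_of_nat_mult)
  also have "\<dots> \<le> exp (real m * (1 / 2))" using m1 by simp
  also have "\<dots> = exp (1 / 2) ^ m" by (rule exp_of_nat_mult)
  also have "\<dots> \<le> 2 ^ m" using e2 by (intro power_mono) auto
  finally have big: "4096 * X \<le> 2 ^ m" .
  \<comment> \<open>Passing from \<open>j\<close> to \<open>j + 1\<close> at most doubles the left
    side once \<open>j \<ge> 2\<close>; smaller values of \<open>k\<close> are checked
    directly.\<close>
  have poly: "(real k + 1) * real k \<le> 2 * 2 ^ k" for k
  proof (induction k rule: less_induct)
    case (less k)
    consider "k = 0" | "k = 1" | "k = 2" | j where "k = Suc j" "j \<ge> 2"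
      by (metis One_nat_def Suc_1 less_2_cases not_less not0_implies_Suc not_less_eq_eq le_antisym)
    then show ?case
    proof cases
      case 4
      then have "(real j + 2) * (real j + 1) \<le> (2 * real j) * (real j + 1)"
        by (intro mult_right_mono) auto
      then have "(real j + 2) * (real j + 1) \<le> 2 * ((real j + 1) * real j)"
        by (simp only: mult_ac)
      then show ?thesis using less [of j] 4 by (simp add: algebra_simps)
    qed auto
  qed
  have bd: "1 \<le> b / \<delta>" using assms by (simp add: field_simps)
  have "(8 * (2 * b)) * (real m + 1) * (10 * real m / \<delta> / 4 ^ m) =
      160 * (b / \<delta>) * (((real m + 1) * real m) / (2 ^ m * 2 ^ m))"
    by (simp flip: power_mult_distrib)
  also have "\<dots> \<le> 160 * (b / \<delta>) * ((2 * 2 ^ m) / (2 ^ m * 2 ^ m))"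
    using bd by (intro mult_left_mono divide_right_mono poly) auto
  also have "\<dots> = 320 * (b / \<delta>) / 2 ^ m" by simp
  finally have "2 / 2 ^ m + (8 * (2 * b)) * (real m + 1) * (10 * real m / \<delta> / 4 ^ m)
      \<le> 2 / 2 ^ m + 320 * (b / \<delta>) / 2 ^ m" by linarith
  also have "\<dots> = (2 + 320 * (b / \<delta>)) / 2 ^ m" by (rule add_divide_distrib [symmetric])
  also have "\<dots> \<le> (322 * (b / \<delta>)) / (4096 * X)"
    using bd big X8 by (intro frac_le) auto
  also have "\<dots> = 322 / 4096 * \<epsilon>" using assms by (simp add: X_def)
  finally have "2 * (2 / 2 ^ m + 8 * (2 * b) * (real m + 1) * (10 * real m / \<delta> / 4 ^ m))
      \<le> 2 * (322 / 4096 * \<epsilon>)" by (rule mult_left_mono) simp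
  also have "\<dots> \<le> \<epsilon>" using assms by simp
  finally have "2 * (2 / 2 ^ m + 8 * (2 * b) * (real m + 1) * (10 * real m / \<delta> / 4 ^ m)) \<le> \<epsilon>" .
  then show ?thesis using m1 unfolding L_def X_def by blast
qed

lemma sup_norm_on_leI:
  assumes "\<And>x. x \<in> I \<Longrightarrow> norm (g x) \<le> B"
  shows "sup_norm_on I g \<le> ennreal B"
  unfolding sup_norm_on_def by (intro SUP_least ennreal_leI assms)

text \<open>The continuation is a separate function \<open>F\<close> agreeing with \<open>f\<close>
  on \<open>[-1,1]\<close>. Both constants are quantified before all parameters and functions, which
  makes them universal; \<open>K\<close> is the constant hidden in the degree bound.\<close>

theorem theorem21:
  "\<exists>C>0. \<exists>K>0. \<forall>(\<alpha>::real) (\<rho>::real) (M::real) (\<delta>::real) (\<epsilon>::real) (b::real)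
      (f :: complex \<Rightarrow> complex) (F :: complex \<Rightarrow> complex).
    \<alpha> > 0 \<longrightarrow> \<rho> = 1 + \<alpha> \<longrightarrow>
    f analytic_on (complex_of_real ` {-1..1}) \<longrightarrow>
    F analytic_on inside (bernstein_ellipse \<rho>) \<longrightarrow>
    (\<forall>x\<in>{-1..1}. F (complex_of_real x) = f (complex_of_real x)) \<longrightarrow>
    (\<forall>z\<in>inside (bernstein_ellipse \<rho>). norm (F z) \<le> M) \<longrightarrow>
    \<delta> \<in> {0<..<1 / C * min 1 (\<alpha>\<^sup>2)} \<longrightarrow> \<epsilon> \<in> {0<..<1} \<longrightarrow> b > 1 \<longrightarrow>
    (\<exists>q :: complex poly.
      real (degree q) \<le> K * (b / \<delta> * ln (b / (\<delta> * \<epsilon>))) \<and>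
      sup_norm_on {-1..1} (\<lambda>x. f (complex_of_real x) - poly q (complex_of_real x))
        \<le> ennreal (M * \<epsilon>) \<and>
      sup_norm_on {-(1 + \<delta>)..1 + \<delta>} (\<lambda>x. poly q (complex_of_real x)) \<le> ennreal M \<and>
      sup_norm_on ({-b..-(1 + \<delta>)} \<union> {1 + \<delta>..b}) (\<lambda>x. poly q (complex_of_real x))
        \<le> ennreal (M * \<epsilon>))"
\<comment> \<open>The 8 is the geometric constant of \<open>cball_subset_focal_region\<close>; 500
  leaves some room above \<open>42 * 11 = 462\<close>.\<close>
proof (rule exI [of _ 8], intro conjI exI [of _ "500 :: real"] allI impI)
  fix \<alpha> \<rho> M \<delta> \<epsilon> b :: real and f F :: "complex \<Rightarrow> complex"
  assume \<alpha>: "\<alpha> > 0" and \<rho>: "\<rho> = 1 + \<alpha>" and ana: "F analytic_on inside (bernstein_ellipse \<rho>)"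
    and Ff: "\<forall>x\<in>{-1..1}. F (complex_of_real x) = f (complex_of_real x)"
    and bound: "\<forall>z\<in>inside (bernstein_ellipse \<rho>). norm (F z) \<le> M"
    and "\<delta> \<in> {0<..<1 / 8 * min 1 (\<alpha>\<^sup>2)}" "\<epsilon> \<in> {0<..<1}" and b: "b > 1"
  then have \<delta>: "0 < \<delta>" "\<delta> < min 1 (\<alpha>\<^sup>2) / 8" and \<epsilon>: "0 < \<epsilon>" "\<epsilon> < 1" by auto
  have \<delta>8: "\<delta> < 1 / 8" using \<delta> by linarith
  define W where "W = {z::complex. norm (z - 1) + norm (z + 1) < \<rho> + 1 / \<rho>}"
  have W: "W \<subseteq> inside (bernstein_ellipse \<rho>)"
    unfolding W_def using \<alpha> \<rho> by (intro focal_region_subset_inside) simp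
  have opn: "open W" unfolding W_def by (intro open_Collect_less continuous_intros)
  have hol: "F holomorphic_on W"
    using ana W analytic_imp_holomorphic holomorphic_on_subset by blast
  have bd: "norm (F z) \<le> M" if "z \<in> W" for z using that W bound by blast
  have sub: "cball (complex_of_real t) \<delta> \<subseteq> W" if "\<bar>t\<bar> \<le> 1 + \<delta>" for t
    unfolding W_def \<rho> by (rule cball_subset_focal_region [OF \<alpha> \<delta> that])
  have M: "M \<ge> 0"
    using bd [of 0] sub [of 0] \<delta> by (smt (verit) centre_in_cball norm_ge_zero subsetD of_real_0)
  obtain m where m: "m > 0" "real m \<le> 11 * ln (b / (\<delta> * \<epsilon>))"
    and E: "2 * (2 / 2 ^ m + 8 * (2 * b) * (real m + 1) * (10 * real m / \<delta> / 4 ^ m)) \<le> \<epsilon>"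
    using truncation_order_exists [OF \<delta>(1) \<delta>8 \<epsilon> b] by blast
  define E where "E = 2 / 2 ^ m + 8 * (2 * b) * (real m + 1) * (10 * real m / \<delta> / 4 ^ m)"
  have E0: "E \<ge> 0" unfolding E_def using b \<delta> by simp
  have E\<epsilon>: "2 * E \<le> \<epsilon>" using E by (simp only: E_def)
  \<comment> \<open>Taking \<open>B = 2 * b\<close> meets the requirement \<open>B \<ge> 2\<close>
    for every \<open>b > 1\<close>.\<close>
  obtain q0 where deg: "real (degree q0) \<le> 21 * (2 * b) * real m / \<delta>"
    and q1: "\<And>x. \<bar>x\<bar> \<le> 1 \<Longrightarrow> norm (F (of_real x) - poly q0 (of_real x)) \<le> M * E"
    and q2: "\<And>x. \<bar>x\<bar> \<le> 1 + \<delta> \<Longrightarrow> norm (poly q0 (of_real x)) \<le> M * (1 + E)"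
    and q3: "\<And>x. 1 + \<delta> \<le> \<bar>x\<bar> \<Longrightarrow> \<bar>x\<bar> \<le> 2 * b \<Longrightarrow> norm (poly q0 (of_real x)) \<le> M * E"
    using localized_taylor_kernel_approx [OF opn hol bd \<delta>(1) _ _ m(1) sub, of "2 * b"] \<delta>8 b
    unfolding E_def by auto
  \<comment> \<open>Rescaling turns the bound \<open>M * (1 + E)\<close> into exactly
    \<open>M\<close>. Since \<open>q0 - q = E * q\<close>, it costs at most another
    \<open>M * E\<close> on \<open>[-1,1]\<close>, hence the condition
    \<open>2 * E \<le> \<epsilon>\<close>.\<close>
  define q where "q = smult (of_real (1 / (1 + E))) q0"
  have q: "norm (poly q z) = norm (poly q0 z) / (1 + E)" for z
    using E0 by (simp add: q_def norm_mult del: of_real_divide)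
  have "ln (b / (\<delta> * \<epsilon>)) \<ge> 0" using m by linarith
  have "degree q \<le> degree q0" unfolding q_def by (rule degree_smult_le)
  then have "real (degree q) \<le> 42 * (b / \<delta>) * real m" using deg by simp
  also have "\<dots> \<le> 42 * (b / \<delta>) * (11 * ln (b / (\<delta> * \<epsilon>)))"
    using m b \<delta> by (intro mult_left_mono) auto
  also have "\<dots> = 462 * (b / \<delta> * ln (b / (\<delta> * \<epsilon>)))" by simp
  also have "\<dots> \<le> 500 * (b / \<delta> * ln (b / (\<delta> * \<epsilon>)))"
    using m b \<delta> \<open>ln (b / (\<delta> * \<epsilon>)) \<ge> 0\<close> by (intro mult_right_mono mult_nonneg_nonneg) auto
  finally have A: "real (degree q) \<le> 500 * (b / \<delta> * ln (b / (\<delta> * \<epsilon>)))" .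
  have B: "norm (poly q (of_real x)) \<le> M" if "\<bar>x\<bar> \<le> 1 + \<delta>" for x
    using q2 [OF that] E0 by (simp add: q pos_divide_le_eq)
  have C: "norm (f (of_real x) - poly q (of_real x)) \<le> M * \<epsilon>" if "x \<in> {-1..1}" for x
  proof -
    have x: "\<bar>x\<bar> \<le> 1" "\<bar>x\<bar> \<le> 1 + \<delta>" using that \<delta> by auto
    have "poly q0 (of_real x) - poly q (of_real x) = of_real E * poly q (of_real x)"
    proof -
      have "complex_of_real (1 + E) * of_real (1 / (1 + E)) = 1"
        using E0 by (simp del: of_real_add of_real_divide flip: of_real_mult)
      then have "poly q0 (of_real x) = of_real (1 + E) * poly q (of_real x)"
        unfolding q_def poly_smult mult.assoc [symmetric] by simp
      then show ?thesis by (simp add: algebra_simps)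
    qed
    then have "norm (poly q0 (of_real x) - poly q (of_real x)) = E * norm (poly q (of_real x))"
      using E0 by (simp add: norm_mult)
    also have "\<dots> \<le> E * M" by (intro mult_left_mono B x E0)
    finally have "norm (F (of_real x) - poly q (of_real x)) \<le> M * E + E * M"
      using q1 [OF x(1)]
        norm_triangle_ineq [of "F (of_real x) - poly q0 (of_real x)" "poly q0 (of_real x) - poly q (of_real x)"]
      by (simp add: mult.commute)
    also have "\<dots> = M * (2 * E)" by simp
    also have "\<dots> \<le> M * \<epsilon>" by (intro mult_left_mono E\<epsilon> M)
    finally show ?thesis using Ff that by simp
  qed
  have D: "norm (poly q (of_real x)) \<le> M * \<epsilon>" if "x \<in> {-b..-(1 + \<delta>)} \<union> {1 + \<delta>..b}" for x
  proof -
    have "1 + \<delta> \<le> \<bar>x\<bar>" "\<bar>x\<bar> \<le> 2 * b" using that b \<delta> by auto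
    then have "norm (poly q0 (of_real x)) \<le> M * E" by (rule q3)
    moreover have "norm (poly q (of_real x)) \<le> norm (poly q0 (of_real x))"
      using E0 by (simp add: q divide_le_eq mult_left_le algebra_simps)
    moreover have "M * E \<le> M * \<epsilon>" using E\<epsilon> E0 by (intro mult_left_mono M) linarith
    ultimately show ?thesis by linarith
  qed
  show "\<exists>q :: complex poly.
      real (degree q) \<le> 500 * (b / \<delta> * ln (b / (\<delta> * \<epsilon>))) \<and>
      sup_norm_on {-1..1} (\<lambda>x. f (complex_of_real x) - poly q (complex_of_real x))
        \<le> ennreal (M * \<epsilon>) \<and>
      sup_norm_on {-(1 + \<delta>)..1 + \<delta>} (\<lambda>x. poly q (complex_of_real x)) \<le> ennreal M \<and>
      sup_norm_on ({-b..-(1 + \<delta>)} \<union> {1 + \<delta>..b}) (\<lambda>x. poly q (complex_of_real x))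
        \<le> ennreal (M * \<epsilon>)"
    using A by (intro exI [of _ q] conjI sup_norm_on_leI C D B) (auto simp: abs_le_iff)
qed auto

end
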